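(* The Leftmost-point Mechanism (Left-M) is strategyproof when both locations and group memberships are private, and has an approximation ratio of $3$ for minimizing the maximum cost; that is, for every profile $\mathbf r$, the output $y$ of Left-M satisfies $\mathrm{MC}(y,\mathbf r)\le 3\min_{z\in[0,1]}\mathrm{MC}(z,\mathbf r)$.
   Context: Setting. $N=\{1,\dots,n\}$ is a set of agents, $I=[0,1]$, $[m]=\{1,\dots,m\}$ indexes groups. Agent $i$ has a profile $r_i=(x_i,g_i)$ with location $x_i\in I$ and group $g_i\in[m]$; $\mathbf r=(r_1,\dots,r_n)$. $G_j=\{i\in N: g_i=j\}$. $d(a,b)=|a-b|$. Each group $j$ has a known externality factor $\alpha_j\ge 0$. If the facility is at $y\in I$, the cost of agent $i$ is $$c_i(y,\mathbf r)=d(y,x_i)+\alpha_{g_i}\sum_{k\in G_{g_i}\setminus\{i\}}(1-d(y,x_k)).$$ Standing assumption on (true) profiles: $\alpha_j\le 1/(|G_j|-1)$ for each group $j$ (void if $|G_j|\le 1$). Maximum cost: $\mathrm{MC}(y,\mathbf r)=\max_{i\in N}c_i(y,\mathbf r)$. A (deterministic) mechanism $f$ maps a profile to a facility location in $I$. Strategyproof when both locations and group memberships are private: for every true profile $\mathbf r$, every reported profile $\mathbf r'$ and every agent $i$, $c_i(f(r_i,\mathbf r'_{-i}),\mathbf r)\le c_i(f(\mathbf r'),\mathbf r)$, where $\mathbf r'_{-i}$ are the reports of all agents other than $i$. Left-M: output $y=\min_{i\in N}x_i$ (the leftmost reported location). *)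

theory Defs
  imports Complex_Main
begin

text \<open>
  The agents are \<open>{1..n}\<close> and the groups are \<open>{1..m}\<close>. A profile assigns to each agent its pair
  (location, group); its values outside \<open>{1..n}\<close> play no role.
\<close>

type_synonym profile = "nat \<Rightarrow> real \<times> nat"

definition profiles :: "nat \<Rightarrow> nat \<Rightarrow> profile set" where
  "profiles n m = {r. \<forall>i\<in>{1..n}. fst (r i) \<in> {0..1} \<and> snd (r i) \<in> {1..m}}"

definition members :: "nat \<Rightarrow> profile \<Rightarrow> nat \<Rightarrow> nat set" where
  "members n r j = {i\<in>{1..n}. snd (r i) = j}"

text \<open>
  The bound on the externality factors is imposed on true profiles only, not on reported ones.
  The bound is void for groups with at most one member; without the guard it would read
  \<open>\<alpha> j \<le> 1 / 0 = 0\<close> for a single member and \<open>\<alpha> j \<le> - 1\<close> for an empty group.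
\<close>

definition true_profiles :: "nat \<Rightarrow> nat \<Rightarrow> (nat \<Rightarrow> real) \<Rightarrow> profile set" where
  "true_profiles n m \<alpha> = {r \<in> profiles n m.
     \<forall>j\<in>{1..m}. card (members n r j) \<ge> 2 \<longrightarrow> \<alpha> j \<le> 1 / (real (card (members n r j)) - 1)}"

definition cost :: "nat \<Rightarrow> (nat \<Rightarrow> real) \<Rightarrow> nat \<Rightarrow> real \<Rightarrow> profile \<Rightarrow> real" where
  "cost n \<alpha> i y r = dist y (fst (r i)) +
     \<alpha> (snd (r i)) * (\<Sum>k\<in>members n r (snd (r i)) - {i}. 1 - dist y (fst (r k)))"

definition max_cost :: "nat \<Rightarrow> (nat \<Rightarrow> real) \<Rightarrow> real \<Rightarrow> profile \<Rightarrow> real" where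
  "max_cost n \<alpha> y r = Max ((\<lambda>i. cost n \<alpha> i y r) ` {1..n})"

text \<open>The infimum is a minimum, see \<open>opt_max_cost_attained\<close> below.\<close>

definition opt_max_cost :: "nat \<Rightarrow> (nat \<Rightarrow> real) \<Rightarrow> profile \<Rightarrow> real" where
  "opt_max_cost n \<alpha> r = (INF z\<in>{0..1}. max_cost n \<alpha> z r)"

text \<open>
  Each agent may misreport both components of its pair. The reports \<open>r'\<close> of all agents are
  arbitrary; \<open>r'(i := r i)\<close> replaces the report of agent \<open>i\<close> by the truth. Costs are evaluated
  at the true profile \<open>r\<close>.
\<close>

definition strategyproof :: "nat \<Rightarrow> nat \<Rightarrow> (nat \<Rightarrow> real) \<Rightarrow> (profile \<Rightarrow> real) \<Rightarrow> bool" where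
  "strategyproof n m \<alpha> f \<longleftrightarrow>
     (\<forall>r\<in>true_profiles n m \<alpha>. \<forall>r'\<in>profiles n m. \<forall>i\<in>{1..n}.
        cost n \<alpha> i (f (r'(i := r i))) r \<le> cost n \<alpha> i (f r') r)"

definition left_M :: "nat \<Rightarrow> profile \<Rightarrow> real" where
  "left_M n r = Min ((\<lambda>i. fst (r i)) ` {1..n})"

lemma left_M_in_unit_interval:
  assumes "n \<ge> 1" "r \<in> profiles n m"
  shows "left_M n r \<in> {0..1}"
proof -
  have "left_M n r \<in> (\<lambda>i. fst (r i)) ` {1..n}"
    unfolding left_M_def using assms(1) by (intro Min_in) auto
  then show ?thesis
    using assms(2) by (auto simp: profiles_def)
qed

lemma continuous_on_max_cost:
  assumes "n \<ge> 1"
  shows "continuous_on S (\<lambda>z. max_cost n \<alpha> z r)"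
proof -
  have cont: "continuous_on S (\<lambda>z. cost n \<alpha> i z r)" for i
    unfolding cost_def by (intro continuous_intros)
  have "continuous_on S (\<lambda>z. Max ((\<lambda>i. cost n \<alpha> i z r) ` A))"
    if "finite A" "A \<noteq> {}" for A
    using that
  proof (induction A rule: finite_ne_induct)
    case (singleton i)
    then show ?case using cont by simp
  next
    case (insert i A)
    then show ?case using continuous_on_max[OF cont[of i]] by simp
  qed
  from this[of "{1..n}"] show ?thesis
    using assms by (simp add: max_cost_def)
qed

lemma opt_max_cost_attained:
  assumes "n \<ge> 1"
  obtains z where "z \<in> {0..1}" "opt_max_cost n \<alpha> r = max_cost n \<alpha> z r"
    "\<And>w. w \<in> {0..1} \<Longrightarrow> max_cost n \<alpha> z r \<le> max_cost n \<alpha> w r"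
proof -
  obtain z where z: "z \<in> {0..1}" "\<forall>w\<in>{0..1}. max_cost n \<alpha> z r \<le> max_cost n \<alpha> w r"
    using continuous_attains_inf[OF compact_Icc _ continuous_on_max_cost[OF assms], of 0 1 \<alpha> r]
    by auto
  have "opt_max_cost n \<alpha> r = max_cost n \<alpha> z r"
    unfolding opt_max_cost_def by (rule cInf_eq_minimum) (use z in auto)
  with z show ?thesis using that by blast
qed

end

theory Submission
  imports Defs
begin

text \<open>
  Since \<open>\<alpha> j * (card (members n r j) - 1) \<le> 1\<close>, the externality part of an agent's cost is
  1-Lipschitz in the facility location. Hence moving the facility straight towards an agent never
  increases that agent's cost. Compared
  with the truthful outcome, a misreport can only move the leftmost point away from the agent, which
  gives strategyproofness. For the ratio, let \<open>y\<close> be the leftmost point and \<open>z\<close> an optimal location: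
  every cost at \<open>y\<close> exceeds the cost at \<open>z\<close> by at most \<open>2 * dist y z\<close>, and the leftmost agent alone
  pays at least \<open>dist y z\<close> at \<open>z\<close>.
\<close>

definition externality :: "nat \<Rightarrow> (nat \<Rightarrow> real) \<Rightarrow> nat \<Rightarrow> real \<Rightarrow> profile \<Rightarrow> real" where
  "externality n \<alpha> i y r =
     \<alpha> (snd (r i)) * (\<Sum>k\<in>members n r (snd (r i)) - {i}. 1 - dist y (fst (r k)))"

lemma cost_eq: "cost n \<alpha> i y r = dist y (fst (r i)) + externality n \<alpha> i y r"
  by (simp add: cost_def externality_def)

lemma finite_members [simp]: "finite (members n r j)"
  by (simp add: members_def)

text \<open>Agent \<open>i\<close> belongs to its own group, so removing it leaves one member fewer
  and the product is the bound on true profiles multiplied out. In a singleton group the product is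
  0, whatever the factor.\<close>

lemma true_profiles_factor_le_1:
  assumes "r \<in> true_profiles n m \<alpha>" "i \<in> {1..n}"
  shows "\<alpha> (snd (r i)) * real (card (members n r (snd (r i)) - {i})) \<le> 1"
proof -
  let ?j = "snd (r i)" and ?G = "members n r (snd (r i))"
  have j: "?j \<in> {1..m}" and i: "i \<in> ?G"
    using assms by (auto simp: true_profiles_def profiles_def members_def)
  have pos: "card ?G > 0"
    using i card_gt_0_iff by fastforce
  have card: "real (card (?G - {i})) = real (card ?G) - 1"
    using i pos by (simp add: of_nat_diff)
  show ?thesis
  proof (cases "card ?G \<ge> 2")
    case True
    then have "\<alpha> ?j \<le> 1 / (real (card ?G) - 1)"
      using assms j by (simp add: true_profiles_def)
    then show ?thesis
      unfolding card using True by (simp add: field_simps)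
  next
    case False
    then have "card ?G = 1"
      using pos by simp
    then show ?thesis
      unfolding card by simp
  qed
qed

text \<open>Each summand is 1-Lipschitz in the location by the triangle inequality, and the factor
  times the number of summands is at most 1.\<close>

lemma externality_lipschitz:
  assumes "r \<in> true_profiles n m \<alpha>" "i \<in> {1..n}" "\<forall>j\<in>{1..m}. \<alpha> j \<ge> 0"
  shows "externality n \<alpha> i y r \<le> externality n \<alpha> i z r + dist y z"
proof -
  let ?a = "\<alpha> (snd (r i))" and ?G = "members n r (snd (r i)) - {i}"
  have a: "?a \<ge> 0"
    using assms by (auto simp: true_profiles_def profiles_def)
  have "(\<Sum>k\<in>?G. 1 - dist y (fst (r k))) \<le> (\<Sum>k\<in>?G. (1 - dist z (fst (r k))) + dist y z)"
    by (intro sum_mono) (simp add: dist_real_def)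
  also have "\<dots> = (\<Sum>k\<in>?G. 1 - dist z (fst (r k))) + real (card ?G) * dist y z"
    by (simp add: sum.distrib)
  finally have "externality n \<alpha> i y r \<le> externality n \<alpha> i z r + (?a * real (card ?G)) * dist y z"
    using a by (auto simp: externality_def mult.assoc simp flip: distrib_left intro: mult_left_mono)
  also have "(?a * real (card ?G)) * dist y z \<le> 1 * dist y z"
    using true_profiles_factor_le_1[OF assms(1,2)] by (intro mult_right_mono) auto
  finally show ?thesis by simp
qed

text \<open>Two points of the unit interval are at distance at most 1. This makes an agent's
  distance to the facility a lower bound on its cost.\<close>

lemma externality_nonneg:
  assumes "r \<in> profiles n m" "i \<in> {1..n}" "\<forall>j\<in>{1..m}. \<alpha> j \<ge> 0" "y \<in> {0..1}"
  shows "externality n \<alpha> i y r \<ge> 0"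
proof -
  have "1 - dist y (fst (r k)) \<ge> 0" if "k \<in> members n r j" for k j
  proof -
    have "fst (r k) \<in> {0..1}"
      using that assms(1) by (auto simp: members_def profiles_def)
    then show ?thesis
      using assms(4) by (auto simp: dist_real_def)
  qed
  moreover have "\<alpha> (snd (r i)) \<ge> 0"
    using assms by (auto simp: profiles_def)
  ultimately show ?thesis
    unfolding externality_def by (intro mult_nonneg_nonneg sum_nonneg) auto
qed

text \<open>The last hypothesis places \<open>y\<close> between \<open>z\<close> and the agent. The
  distance term then falls by exactly \<open>dist z y\<close>, which pays for any rise of the
  externality.\<close>

lemma cost_mono_towards:
  assumes "r \<in> true_profiles n m \<alpha>" "i \<in> {1..n}" "\<forall>j\<in>{1..m}. \<alpha> j \<ge> 0"
    and "dist z (fst (r i)) = dist z y + dist y (fst (r i))"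
  shows "cost n \<alpha> i y r \<le> cost n \<alpha> i z r"
  using externality_lipschitz[OF assms(1-3), of y z] assms(4) by (simp add: cost_eq dist_commute)

text \<open>The distance term and the externality contribute one \<open>dist y z\<close>
  each.\<close>

lemma cost_lipschitz:
  assumes "r \<in> true_profiles n m \<alpha>" "i \<in> {1..n}" "\<forall>j\<in>{1..m}. \<alpha> j \<ge> 0"
  shows "cost n \<alpha> i y r \<le> cost n \<alpha> i z r + 2 * dist y z"
  using externality_lipschitz[OF assms, of y z] dist_triangle[of y "fst (r i)" z]
  by (simp add: cost_eq)

lemma cost_le_max_cost: "i \<in> {1..n} \<Longrightarrow> cost n \<alpha> i y r \<le> max_cost n \<alpha> y r"
  unfolding max_cost_def by (intro Max_ge) auto

lemma left_M_le: "i \<in> {1..n} \<Longrightarrow> left_M n r \<le> fst (r i)"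
  unfolding left_M_def by (intro Min_le) auto

lemma left_M_attained:
  assumes "n \<ge> 1"
  obtains i where "i \<in> {1..n}" "fst (r i) = left_M n r"
proof -
  have "left_M n r \<in> (\<lambda>i. fst (r i)) ` {1..n}"
    unfolding left_M_def using assms by (intro Min_in) auto
  then show ?thesis using that by auto
qed

text \<open>If the truthful minimum is attained by some \<open>k\<close> other than
  \<open>i\<close>, the same report of \<open>k\<close> occurs in \<open>r'\<close> and bounds its
  minimum from above.\<close>

lemma left_M_truthful_cases:
  assumes "i \<in> {1..n}"
  shows "left_M n (r'(i := r i)) = fst (r i) \<or>
    left_M n r' \<le> left_M n (r'(i := r i)) \<and> left_M n (r'(i := r i)) \<le> fst (r i)"
proof -
  have "n \<ge> 1" using assms by simp
  then obtain k where k: "k \<in> {1..n}" "fst ((r'(i := r i)) k) = left_M n (r'(i := r i))"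
    by (rule left_M_attained)
  show ?thesis
  proof (cases "k = i")
    case False
    then show ?thesis
      using k left_M_le[of k n r'] left_M_le[OF assms, of "r'(i := r i)"] by simp
  qed (use k in simp)
qed

lemma strategyproof_left_M:
  assumes "\<forall>j\<in>{1..m}. \<alpha> j \<ge> 0"
  shows "strategyproof n m \<alpha> (left_M n)"
  unfolding strategyproof_def
proof (intro ballI)
  fix r r' i
  assume r: "r \<in> true_profiles n m \<alpha>" and i: "i \<in> {1..n}"
  show "cost n \<alpha> i (left_M n (r'(i := r i))) r \<le> cost n \<alpha> i (left_M n r') r"
    \<comment> \<open>Either the truthful outcome is the agent's own location, or it lies between
      the misreport's outcome and that location; both give the distance equation.\<close>
    using left_M_truthful_cases[OF i, of r' r]
    by (intro cost_mono_towards[OF r i assms]) (auto simp: dist_real_def)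
qed

lemma max_cost_left_M_le:
  assumes "n \<ge> 1" "\<forall>j\<in>{1..m}. \<alpha> j \<ge> 0" "r \<in> true_profiles n m \<alpha>" "z \<in> {0..1}"
  shows "max_cost n \<alpha> (left_M n r) r \<le> 3 * max_cost n \<alpha> z r"
proof -
  let ?y = "left_M n r"
  obtain l where l: "l \<in> {1..n}" "fst (r l) = ?y"
    using left_M_attained[OF assms(1)] .
  have r: "r \<in> profiles n m"
    using assms(3) by (simp add: true_profiles_def)
  have "dist z ?y \<le> cost n \<alpha> l z r"
    using externality_nonneg[OF r l(1) assms(2,4)] l(2) by (simp add: cost_eq)
  also have "\<dots> \<le> max_cost n \<alpha> z r"
    by (rule cost_le_max_cost[OF l(1)])
  finally have dist: "dist z ?y \<le> max_cost n \<alpha> z r" .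
  \<comment> \<open>The 3 is 1 + 2: the agent's cost at \<open>z\<close>, plus twice
    \<open>dist z ?y\<close>.\<close>
  have "cost n \<alpha> i ?y r \<le> 3 * max_cost n \<alpha> z r" if i: "i \<in> {1..n}" for i
    using cost_lipschitz[OF assms(3) i assms(2), of ?y z] cost_le_max_cost[OF i, of \<alpha> z r] dist
    by (simp add: dist_commute)
  then show ?thesis
    using assms(1) by (simp add: max_cost_def)
qed

theorem theorem5:
  fixes n m :: nat and \<alpha> :: "nat \<Rightarrow> real"
  assumes "n \<ge> 1"
    and "\<forall>j\<in>{1..m}. \<alpha> j \<ge> 0"
  shows "strategyproof n m \<alpha> (left_M n) \<and>
    (\<forall>r\<in>true_profiles n m \<alpha>. max_cost n \<alpha> (left_M n r) r \<le> 3 * opt_max_cost n \<alpha> r)"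
proof (intro conjI ballI)
  show "strategyproof n m \<alpha> (left_M n)"
    by (rule strategyproof_left_M[OF assms(2)])
next
  fix r assume r: "r \<in> true_profiles n m \<alpha>"
  obtain z where z: "z \<in> {0..1}" "opt_max_cost n \<alpha> r = max_cost n \<alpha> z r"
    using opt_max_cost_attained[OF assms(1)] by metis
  then show "max_cost n \<alpha> (left_M n r) r \<le> 3 * opt_max_cost n \<alpha> r"
    using max_cost_left_M_le[OF assms r z(1)] by simp
qed

end
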